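(* Let $p\in[1,\infty]$ and let $(X,\|\cdot\|_X)$ be a rearrangement-invariant space over $([0,\infty),\lambda)$ whose norm $\|\cdot\|_X$ is equivalent to a $p$-homogeneous rearrangement-invariant norm. Then the following assertions are true: (i) If $p=1$, then $X=L^1$. (ii) If $p\in(1,\infty)$, then $L^{p,1}\hookrightarrow X\hookrightarrow L^{p,\infty}$. (iii) If $p=\infty$, then $X=L^\infty$.
   Context: $\lambda$ is Lebesgue measure on $[0,\infty)$ and $\mathfrak M([0,\infty))$ is the set of real-valued Lebesgue-measurable functions on $[0,\infty)$ (a.e. equal functions are identified). For $f\in\mathfrak M([0,\infty))$ and $t>0$, $f^*(t)=\inf\{s>0: \lambda(\{x:|f(x)|>s\})\le t\}$ and $f^{**}(t)=\frac1t\int_0^t f^*(s)\,\mathrm ds$. A mapping $\|\cdot\|:\mathfrak M([0,\infty))\to[0,\infty]$ is a rearrangement-invariant (r.i.) norm if for all $f,g,f_n\in\mathfrak M([0,\infty))$ ($n\in\mathbb N$), all $a\in\mathbb R$ and all measurable $E\subset[0,\infty)$: (P1) $\|f+g\|\le\|f\|+\|g\|$, $\|af\|=|a|\|f\|$, and $\|f\|=0\Leftrightarrow f=0$ a.e.; (P2) $0\le g\le f$ a.e. implies $\|g\|\le\|f\|$; (P3) $0\le f_n\uparrow f$ a.e. implies $\|f_n\|\uparrow\|f\|$; (P4) $\lambda(E)<\infty$ implies $\|\chi_E\|<\infty$; (P5) if $\lambda(E)<\infty$ there is $C_E\in(0,\infty)$ depending only on $E$ (and the norm) with $\int_E f\,\mathrm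 d\lambda\le C_E\|f\|$ for all $f\ge0$; (P6) $f^*=g^*$ implies $\|f\|=\|g\|$. The r.i. space generated by an r.i. norm $\|\cdot\|_X$ is $X=\{f\in\mathfrak M([0,\infty)):\|f\|_X<\infty\}$. For $r>0$ the dilation operator is $D_rf(t)=f(rt)$. Convention: $t^{\frac1\infty}=t^{-\frac1\infty}=1$ for all $t>0$. For $p\in[1,\infty]$, an r.i. norm $\|\cdot\|_X$ is $p$-homogeneous if $\|D_rf\|_X=r^{-\frac1p}\|f\|_X$ for every $f\in X$ and $r>0$. Two norms are equivalent if each is bounded by a constant multiple of the other. $X\hookrightarrow Y$ means $X\subset Y$ and there is $C>0$ with $\|f\|_Y\le C\|f\|_X$ for every $f\in X$. Equalities $X=L^1$, $X=L^\infty$ are equalities of sets (the norms are then automatically equivalent); $L^1,L^\infty$ are over $([0,\infty),\lambda)$. For $p\in(1,\infty)$: $L^{p,1}=\{f\in\mathfrak M([0,\infty)): \|f\|_{(p,1)}=\int_0^\infty f^{**}(t)\,t^{\frac1p-1}\,\mathrm dt<\infty\}$ and $L^{p,\infty}=\{f\in\mathfrak M([0,\infty)): \|f\|_{(p,\infty)}=\sup_{t>0}f^{**}(t)\,t^{\frac1p}<\infty\}$, with the indicated norms. *)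

theory Defs
  imports "HOL-Analysis.Analysis"
begin

abbreviation halfline :: "real measure" where
  "halfline \<equiv> lebesgue_on {0..}"

text \<open>
  Functions on \<open>[0, \<infinity>)\<close> are represented by functions \<open>real \<Rightarrow> real\<close> whose values on the
  negative half-line are irrelevant: everything below depends on \<open>f\<close> only through its
  restriction to \<open>{0..}\<close>, and in fact only through its a.e. class.
\<close>

definition meas_funs :: "(real \<Rightarrow> real) set" where
  "meas_funs = borel_measurable halfline"

text \<open>
  The rearrangement is \<open>ennreal\<close>-valued, because the set below may be empty, in which
  case its infimum is \<open>\<infinity>\<close>.  Only arguments \<open>t > 0\<close> are meaningful.
\<close>

definition rearr :: "(real \<Rightarrow> real) \<Rightarrow> real \<Rightarrow> ennreal" where
  "rearr f t = Inf {ennreal s | s. s > 0 \<and>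
     emeasure halfline {x \<in> space halfline. \<bar>f x\<bar> > s} \<le> ennreal t}"

definition max_rearr :: "(real \<Rightarrow> real) \<Rightarrow> real \<Rightarrow> ennreal" where
  "max_rearr f t = ennreal (1 / t) * (\<integral>\<^sup>+s\<in>{0<..<t}. rearr f s \<partial>lebesgue)"

text \<open>
  A norm is a total function on \<open>real \<Rightarrow> real\<close>, constrained only on \<^const>\<open>meas_funs\<close>.
  That it takes the same value on a.e. equal functions is a consequence of \<open>P6\<close>.
  In \<open>P1_scale\<close> the convention \<open>0 * \<infinity> = 0\<close> of \<^typ>\<open>ennreal\<close> is used.
\<close>

locale ri_norm =
  fixes N :: "(real \<Rightarrow> real) \<Rightarrow> ennreal"
  assumes P1_triangle: "\<And>f g. f \<in> meas_funs \<Longrightarrow> g \<in> meas_funs \<Longrightarrow> N (\<lambda>x. f x + g x) \<le> N f + N g"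
    and P1_scale: "\<And>f a. f \<in> meas_funs \<Longrightarrow> N (\<lambda>x. a * f x) = ennreal \<bar>a\<bar> * N f"
    and P1_zero: "\<And>f. f \<in> meas_funs \<Longrightarrow> N f = 0 \<longleftrightarrow> (AE x in halfline. f x = 0)"
    and P2: "\<And>f g. f \<in> meas_funs \<Longrightarrow> g \<in> meas_funs \<Longrightarrow>
        (AE x in halfline. 0 \<le> g x \<and> g x \<le> f x) \<Longrightarrow> N g \<le> N f"
    and P3: "\<And>F f. (\<And>n::nat. F n \<in> meas_funs) \<Longrightarrow> f \<in> meas_funs \<Longrightarrow>
        (AE x in halfline. (\<forall>n. 0 \<le> F n x) \<and> incseq (\<lambda>n. F n x) \<and> (\<lambda>n. F n x) \<longlonglongrightarrow> f x) \<Longrightarrow>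
        incseq (\<lambda>n. N (F n)) \<and> (\<lambda>n. N (F n)) \<longlonglongrightarrow> N f"
    and P4: "\<And>E. E \<in> sets halfline \<Longrightarrow> emeasure halfline E < \<infinity> \<Longrightarrow> N (indicator E) < \<infinity>"
    and P5: "\<And>E. E \<in> sets halfline \<Longrightarrow> emeasure halfline E < \<infinity> \<Longrightarrow>
        \<exists>C::real. C > 0 \<and> (\<forall>f\<in>meas_funs. (AE x in halfline. 0 \<le> f x) \<longrightarrow>
          (\<integral>\<^sup>+x\<in>E. ennreal (f x) \<partial>halfline) \<le> ennreal C * N f)"
    and P6: "\<And>f g. f \<in> meas_funs \<Longrightarrow> g \<in> meas_funs \<Longrightarrow>
        (\<forall>t>0. rearr f t = rearr g t) \<Longrightarrow> N f = N g"

definition fun_space :: "((real \<Rightarrow> real) \<Rightarrow> ennreal) \<Rightarrow> (real \<Rightarrow> real) set" where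
  "fun_space N = {f \<in> meas_funs. N f < \<infinity>}"

definition dilation :: "real \<Rightarrow> (real \<Rightarrow> real) \<Rightarrow> real \<Rightarrow> real" where
  "dilation r f = (\<lambda>t. f (r * t))"

text \<open>
  The exponent \<open>1/p\<close> for \<open>p \<in> [1, \<infinity>]\<close>, which is \<open>0\<close> for \<open>p = \<infinity>\<close>; hence
  \<open>t powr recip \<infinity> = t powr (- recip \<infinity>) = 1\<close> for \<open>t > 0\<close>.
\<close>

definition recip :: "ennreal \<Rightarrow> real" where
  "recip p = enn2real (1 / p)"

definition p_homogeneous :: "ennreal \<Rightarrow> ((real \<Rightarrow> real) \<Rightarrow> ennreal) \<Rightarrow> bool" where
  "p_homogeneous p N \<longleftrightarrow>
     (\<forall>f\<in>fun_space N. \<forall>r>0. N (dilation r f) = ennreal (r powr (- recip p)) * N f)"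

definition equivalent_norms ::
    "((real \<Rightarrow> real) \<Rightarrow> ennreal) \<Rightarrow> ((real \<Rightarrow> real) \<Rightarrow> ennreal) \<Rightarrow> bool" where
  "equivalent_norms N N' \<longleftrightarrow>
     (\<exists>C::real. C > 0 \<and> (\<forall>f\<in>meas_funs. N f \<le> ennreal C * N' f)) \<and>
     (\<exists>C::real. C > 0 \<and> (\<forall>f\<in>meas_funs. N' f \<le> ennreal C * N f))"

definition embeds ::
    "((real \<Rightarrow> real) \<Rightarrow> ennreal) \<Rightarrow> ((real \<Rightarrow> real) \<Rightarrow> ennreal) \<Rightarrow> bool" where
  "embeds NX NY \<longleftrightarrow> fun_space NX \<subseteq> fun_space NY \<and>
     (\<exists>C::real. C > 0 \<and> (\<forall>f\<in>fun_space NX. NY f \<le> ennreal C * NX f))"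

definition L1_space :: "(real \<Rightarrow> real) set" where
  "L1_space = {f \<in> meas_funs. integrable halfline f}"

definition Linf_space :: "(real \<Rightarrow> real) set" where
  "Linf_space = {f \<in> meas_funs. \<exists>C::real. AE x in halfline. \<bar>f x\<bar> \<le> C}"

definition lorentz_1_norm :: "ennreal \<Rightarrow> (real \<Rightarrow> real) \<Rightarrow> ennreal" where
  "lorentz_1_norm p f = (\<integral>\<^sup>+t\<in>{0<..}. max_rearr f t * ennreal (t powr (recip p - 1)) \<partial>lebesgue)"

definition lorentz_inf_norm :: "ennreal \<Rightarrow> (real \<Rightarrow> real) \<Rightarrow> ennreal" where
  "lorentz_inf_norm p f = (SUP t\<in>{0<..}. max_rearr f t * ennreal (t powr recip p))"

end

theory Submission
  imports Defs
begin

text \<open>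
  Write \<open>r = 1/p\<close>.  Finiteness and domination of norms up to constants do not change under passage to an
  equivalent norm, so let \<open>N\<close> itself be homogeneous.  An indicator function of a set of measure \<open>a\<close> is
  equimeasurable with a dilation of the indicator function of \<open>[0, 1)\<close>, so its norm is a constant times
  \<open>a powr r\<close> (\<open>N_indicator\<close>).

  The upper bound for \<open>N f\<close> comes from cutting \<open>f\<close> into dyadic level sets.  Subadditivity and the Fatou
  property bound \<open>N f\<close> by \<open>\<Sum>k. 2^k * N (indicator {\<bar>f\<bar> > 2^k})\<close>; as \<open>a powr r\<close> is a multiple of the integral
  of \<open>t powr (r - 1)\<close> over \<open>(0, a)\<close>, the sum is at most a multiple of the integral of
  \<open>rearr f t * t powr (r - 1)\<close> (\<open>N_le_weighted_rearr\<close>), and \<open>f\<^sup>* \<le> f\<^sup>*\<^sup>*\<close>.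

  The lower bound \<open>f\<^sup>*\<^sup>*(t) \<le> C * t powr (- r) * N f\<close> (\<open>max_rearr_le_N\<close>) avoids averaging operators and
  duality: \<open>f\<^sup>*\<^sup>*(t)\<close> is the integral over \<open>[0, 1)\<close> of the dilated rearrangement \<open>s \<mapsto> f\<^sup>*(t * s)\<close>, so local
  integrability (P5) on the single set \<open>[0, 1)\<close> bounds it by a multiple of the norm of that function,
  which homogeneity and rearrangement invariance evaluate as \<open>t powr (- r) * N f\<close>.

  For \<open>1 < p < \<infinity>\<close> the two bounds are the two embeddings.  For \<open>p = 1\<close> both concern the integral of \<open>f\<^sup>*\<close>,
  which equals the integral of \<open>\<bar>f\<bar>\<close> by the layer cake formula.  For \<open>p = \<infinity>\<close> all sets of positive finite
  measure have the same norm, which forces \<open>L\<^sup>\<infinity>\<close> directly.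
\<close>

section \<open>Distribution function and rearrangement\<close>

definition dist_fun :: "(real \<Rightarrow> real) \<Rightarrow> real \<Rightarrow> ennreal" where
  "dist_fun f s = emeasure halfline {x \<in> space halfline. \<bar>f x\<bar> > s}"

lemma halfline_sets_borel: "A \<in> sets borel \<Longrightarrow> A \<subseteq> {0..} \<Longrightarrow> A \<in> sets halfline"
  by (auto simp: sets_restrict_space_iff)

lemma emeasure_halfline_borel:
  "A \<in> sets borel \<Longrightarrow> A \<subseteq> {0..} \<Longrightarrow> emeasure halfline A = emeasure lborel A"
  by (simp add: emeasure_restrict_space)

lemma sets_halfline_interval: "{0..<a::real} \<in> sets halfline"
  by (auto intro!: halfline_sets_borel)

lemma emeasure_halfline_interval: "0 \<le> a \<Longrightarrow> emeasure halfline {0..<a::real} = ennreal a"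
  by (subst emeasure_halfline_borel) auto

lemma meas_funs_borel: "f \<in> borel_measurable borel \<Longrightarrow> f \<in> meas_funs"
  unfolding meas_funs_def
  by (intro measurable_restrict_space1 measurable_completion) simp

lemma meas_funs_measurable: "f \<in> meas_funs \<Longrightarrow> f \<in> borel_measurable halfline"
  by (simp add: meas_funs_def)

lemma level_sets:
  assumes "f \<in> meas_funs"
  shows "{x \<in> {0..}. s < \<bar>f x\<bar>} \<in> sets halfline"
proof -
  have [measurable]: "f \<in> borel_measurable halfline"
    by (rule meas_funs_measurable) fact
  have "{x \<in> space halfline. s < \<bar>f x\<bar>} \<in> sets halfline"
    by measurable
  then show ?thesis by simp
qed

lemma dist_fun_antimono:
  assumes "f \<in> meas_funs" "s \<le> s'"
  shows "dist_fun f s' \<le> dist_fun f s"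
  unfolding dist_fun_def using level_sets[OF assms(1)] assms(2)
  by (intro emeasure_mono) auto

text \<open>
  The level set \<open>{\<bar>f\<bar> > s}\<close> is the increasing union of the sets \<open>{\<bar>f\<bar> > s + 1/(n+1)}\<close>, and measures
  are continuous from below, also where they are infinite.
\<close>

lemma dist_fun_right_continuous:
  assumes f: "f \<in> meas_funs" and a: "a < dist_fun f s"
  shows "\<exists>s'>s. a < dist_fun f s'"
proof -
  define A where "A n = {x \<in> {0..}. s + 1 / Suc n < \<bar>f x\<bar>}" for n
  have U: "(\<Union>n. A n) = {x \<in> {0..}. s < \<bar>f x\<bar>}"
  proof safe
    fix x :: real assume x: "0 \<le> x" "s < \<bar>f x\<bar>"
    then obtain n where "1 / Suc n < \<bar>f x\<bar> - s"
      using nat_approx_posE[of "\<bar>f x\<bar> - s"] by auto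
    then show "x \<in> (\<Union>n. A n)"
      using x by (auto simp: A_def intro!: exI[of _ n])
  next
    fix x n assume "x \<in> A n"
    then have "s + 1 / Suc n < \<bar>f x\<bar>" by (simp add: A_def)
    moreover have "0 < 1 / real (Suc n)" by simp
    ultimately show "s < \<bar>f x\<bar>" by linarith
  qed (auto simp: A_def)
  have "incseq A"
  proof (rule incseq_SucI)
    fix n
    have "1 / real (Suc (Suc n)) \<le> 1 / Suc n" by (simp add: field_simps)
    then show "A n \<subseteq> A (Suc n)" unfolding A_def by auto
  qed
  moreover have "range A \<subseteq> sets halfline"
    unfolding A_def using level_sets[OF f] by blast
  ultimately have "(SUP n. emeasure halfline (A n)) = dist_fun f s"
    using SUP_emeasure_incseq[of A halfline] U by (simp add: dist_fun_def)
  then obtain n where "a < emeasure halfline (A n)"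
    using a by (metis less_SUP_iff)
  then show ?thesis
    by (intro exI[of _ "s + 1 / Suc n"]) (auto simp: dist_fun_def A_def)
qed

text \<open>
  The rearrangement is the generalised inverse of the distribution function.  Right-continuity of
  the latter makes the correspondence exact for strict inequalities.
\<close>

lemma less_rearr_iff:
  assumes f: "f \<in> meas_funs" and s: "0 \<le> s"
  shows "ennreal s < rearr f t \<longleftrightarrow> ennreal t < dist_fun f s"
proof
  assume "ennreal t < dist_fun f s"
  then obtain s' where s': "s < s'" "ennreal t < dist_fun f s'"
    using dist_fun_right_continuous[OF f] by blast
  have "ennreal s' \<le> rearr f t"
    unfolding rearr_def dist_fun_def[symmetric]
  proof (rule Inf_greatest, safe)
    fix u assume u: "0 < u" "dist_fun f u \<le> ennreal t"
    have "\<not> u \<le> s'"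
      using dist_fun_antimono[OF f, of u s'] u s'(2) by auto
    then show "ennreal s' \<le> ennreal u" by (simp add: ennreal_leI)
  qed
  then show "ennreal s < rearr f t"
    using s s'(1) by (meson ennreal_lessI less_le_trans le_less_trans)
next
  assume "ennreal s < rearr f t"
  then obtain z where z: "ennreal s < z" "z < rearr f t"
    using dense by blast
  then obtain s' where s': "z = ennreal s'" "0 \<le> s'"
    by (cases z) auto
  then have "s < s'" using z s by (simp add: ennreal_less_iff)
  show "ennreal t < dist_fun f s"
  proof (rule ccontr)
    assume "\<not> ennreal t < dist_fun f s"
    then have "dist_fun f s' \<le> ennreal t"
      using dist_fun_antimono[OF f, of s s'] \<open>s < s'\<close> by simp
    then have "rearr f t \<le> ennreal s'"
      unfolding rearr_def dist_fun_def[symmetric] using \<open>s < s'\<close> s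
      by (intro Inf_lower) auto
    then show False using z s' by simp
  qed
qed

lemma rearr_cong:
  assumes "\<And>s. 0 < s \<Longrightarrow> dist_fun f s = dist_fun g s"
  shows "rearr f = rearr g"
  unfolding rearr_def dist_fun_def[symmetric] fun_eq_iff
  by (intro allI arg_cong[where f=Inf] Collect_cong) (auto simp: assms)

lemma rearr_antimono:
  assumes "s \<le> t" shows "rearr f t \<le> rearr f s"
  unfolding rearr_def
  by (rule Inf_superset_mono) (use ennreal_leI[OF assms] in \<open>auto intro: order_trans\<close>)

lemma rearr_measurable [measurable]:
  assumes "f \<in> meas_funs"
  shows "rearr f \<in> borel_measurable borel"
proof (rule borel_measurableI_greater)
  fix y :: ennreal
  show "{x \<in> space borel. y < rearr f x} \<in> sets borel"
    by (cases y) (simp_all add: less_rearr_iff[OF assms])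
qed

lemma max_rearr_eq:
  "max_rearr f t = ennreal (1 / t) * (\<integral>\<^sup>+s\<in>{0<..<t}. rearr f s \<partial>lborel)"
  by (simp add: max_rearr_def nn_integral_completion)

section \<open>Integrals of the rearrangement\<close>

text \<open>
  The set is the interval \<open>(0, m)\<close>, written so that \<open>m\<close> may be infinite.
\<close>

lemma emeasure_Ioo_0_less:
  "emeasure lborel {t. 0 < t \<and> ennreal t < m} = m"
proof (cases m)
  case (real a)
  then have "{t. 0 < t \<and> ennreal t < m} = {0<..<a}"
    by (auto simp: ennreal_less_iff)
  then show ?thesis using real by simp
next
  case top
  then have "{t. 0 < t \<and> ennreal t < m} = {0<..}" by auto
  moreover have "emeasure lborel {0::real<..} = \<infinity>"
  proof -
    have "ennreal (real n) \<le> emeasure lborel {0::real<..}" for n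
    proof -
      have "emeasure lborel {0<..real n} \<le> emeasure lborel {0::real<..}"
        by (intro emeasure_mono) auto
      then show ?thesis by simp
    qed
    then show ?thesis
      by (metis ennreal_of_nat_eq_real_of_nat ennreal_SUP_of_nat_eq_top SUP_least top_le infinity_ennreal_def)
  qed
  ultimately show ?thesis using top by simp
qed

lemma max_rearr_ge:
  assumes "f \<in> meas_funs" "0 < t" shows "rearr f t \<le> max_rearr f t"
proof -
  have "ennreal t * rearr f t = (\<integral>\<^sup>+s\<in>{0<..<t}. rearr f t \<partial>lborel)"
    using assms(2) by (simp add: nn_integral_cmult_indicator mult.commute)
  also have "\<dots> \<le> (\<integral>\<^sup>+s\<in>{0<..<t}. rearr f s \<partial>lborel)"
    by (intro nn_integral_mono) (auto simp: indicator_def rearr_antimono)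
  finally have "ennreal (1 / t) * (ennreal t * rearr f t) \<le> max_rearr f t"
    unfolding max_rearr_eq by (intro mult_left_mono) auto
  moreover have "ennreal (1 / t) * (ennreal t * rearr f t) = rearr f t"
    using assms(2) by (simp add: mult.assoc[symmetric] ennreal_mult'[symmetric])
  ultimately show ?thesis by simp
qed

text \<open>
  By Tonelli, since \<open>h x\<close> is the length of \<open>{s > 0. s < h x}\<close>.
\<close>

lemma nn_integral_layer_cake:
  assumes "sigma_finite_measure M" and h [measurable]: "h \<in> borel_measurable M"
  shows "(\<integral>\<^sup>+x. h x \<partial>M) = (\<integral>\<^sup>+s\<in>{0<..}. emeasure M {x \<in> space M. ennreal s < h x} \<partial>lborel)"
proof -
  interpret sigma_finite_measure M by fact
  interpret P: pair_sigma_finite M lborel ..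
  have "(\<integral>\<^sup>+x. h x \<partial>M) = (\<integral>\<^sup>+x. (\<integral>\<^sup>+s. indicator {s. 0 < s \<and> ennreal s < h x} s \<partial>lborel) \<partial>M)"
    by (intro nn_integral_cong) (simp add: emeasure_Ioo_0_less)
  also have "\<dots> = (\<integral>\<^sup>+x. (\<integral>\<^sup>+s. indicator {s. 0 < s} s * indicator {x\<in>space M. ennreal s < h x} x \<partial>lborel) \<partial>M)"
    by (intro nn_integral_cong) (auto simp: indicator_def)
  also have "\<dots> = (\<integral>\<^sup>+s. (\<integral>\<^sup>+x. indicator {s. 0 < s} s * indicator {x\<in>space M. ennreal s < h x} x \<partial>M) \<partial>lborel)"
    by (rule P.Fubini'[symmetric]) measurable
  also have "\<dots> = (\<integral>\<^sup>+s\<in>{0<..}. emeasure M {x \<in> space M. ennreal s < h x} \<partial>lborel)"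
    by (intro nn_integral_cong) (simp add: nn_integral_cmult mult.commute, simp add: indicator_def)
  finally show ?thesis .
qed

lemma sigma_finite_halfline: "sigma_finite_measure halfline"
proof
  show "\<exists>A. countable A \<and> A \<subseteq> sets halfline \<and> \<Union>A = space halfline \<and> (\<forall>a\<in>A. emeasure halfline a \<noteq> \<infinity>)"
  proof (intro exI[of _ "range (\<lambda>n. {0..real n})"] conjI ballI)
    show "\<Union>(range (\<lambda>n. {0..real n})) = space halfline"
      by (auto intro: real_arch_simple)
  qed (auto simp: emeasure_halfline_borel intro!: halfline_sets_borel)
qed

text \<open>
  By the layer cake formula both integrals depend on the distribution functions only, and those of
  \<open>rearr f\<close> and \<open>\<bar>f\<bar>\<close> agree.
\<close>

lemma nn_integral_rearr:
  assumes f: "f \<in> meas_funs"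
  shows "(\<integral>\<^sup>+t\<in>{0<..}. rearr f t \<partial>lborel) = (\<integral>\<^sup>+x. ennreal \<bar>f x\<bar> \<partial>halfline)"
proof -
  have [measurable]: "f \<in> borel_measurable halfline" "rearr f \<in> borel_measurable borel"
    using f by (auto intro: meas_funs_measurable rearr_measurable)
  have *: "{t. ennreal s < rearr f t * indicator {0<..} t} = {t. 0 < t \<and> ennreal t < dist_fun f s}"
    if "0 < s" for s
    using that less_rearr_iff[OF f, of s] by (auto simp: indicator_def split: if_splits)
  have "(\<integral>\<^sup>+t\<in>{0<..}. rearr f t \<partial>lborel)
      = (\<integral>\<^sup>+s\<in>{0<..}. emeasure lborel {t. ennreal s < rearr f t * indicator {0<..} t} \<partial>lborel)"
    using nn_integral_layer_cake[OF sigma_finite_lborel, of "\<lambda>t. rearr f t * indicator {0<..} t"] by simp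
  also have "\<dots> = (\<integral>\<^sup>+s\<in>{0<..}. dist_fun f s \<partial>lborel)"
    by (intro nn_integral_cong) (simp add: * emeasure_Ioo_0_less del: mem_Collect_eq indicator_simps split: split_indicator)
  also have "\<dots> = (\<integral>\<^sup>+s\<in>{0<..}. emeasure halfline {x \<in> space halfline. ennreal s < ennreal \<bar>f x\<bar>} \<partial>lborel)"
    by (intro nn_integral_cong) (auto simp: indicator_def dist_fun_def ennreal_less_iff)
  also have "\<dots> = (\<integral>\<^sup>+x. ennreal \<bar>f x\<bar> \<partial>halfline)"
    by (rule nn_integral_layer_cake[OF sigma_finite_halfline, symmetric]) measurable
  finally show ?thesis .
qed

text \<open>
  A real-valued copy of the rearrangement, to which an r.i. norm can be applied.  The value on
  \<open>{..0}\<close> is immaterial.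
\<close>

definition rearr_real :: "(real \<Rightarrow> real) \<Rightarrow> real \<Rightarrow> real" where
  "rearr_real f t = (if 0 < t then enn2real (rearr f t) else 0)"

lemma rearr_real_measurable [measurable]:
  "f \<in> meas_funs \<Longrightarrow> rearr_real f \<in> borel_measurable borel"
  unfolding rearr_real_def by measurable

lemma rearr_rearr_real:
  assumes f: "f \<in> meas_funs" and fin: "\<And>t. 0 < t \<Longrightarrow> rearr f t < \<infinity>"
  shows "rearr (rearr_real f) = rearr f"
proof (rule rearr_cong)
  fix s :: real assume s: "0 < s"
  have "{x \<in> {0..}. s < \<bar>rearr_real f x\<bar>} = {t. 0 < t \<and> ennreal t < dist_fun f s}"
  proof (rule Collect_cong)
    fix t
    have "s < enn2real (rearr f t) \<longleftrightarrow> ennreal t < dist_fun f s" if "0 < t"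
    proof -
      have "ennreal (enn2real (rearr f t)) = rearr f t"
        using fin[OF that] by simp
      then show ?thesis
        using less_rearr_iff[OF f, of s t] s by (metis ennreal_less_iff less_imp_le)
    qed
    then show "t \<in> {0..} \<and> s < \<bar>rearr_real f t\<bar> \<longleftrightarrow> 0 < t \<and> ennreal t < dist_fun f s"
      using s by (auto simp: rearr_real_def)
  qed
  moreover have "{t. 0 < t \<and> ennreal t < dist_fun f s} \<in> sets borel"
    by measurable
  then have "emeasure halfline {t. 0 < t \<and> ennreal t < dist_fun f s} = dist_fun f s"
    by (subst emeasure_halfline_borel) (auto simp: emeasure_Ioo_0_less)
  ultimately show "dist_fun (rearr_real f) s = dist_fun f s"
    by (simp add: dist_fun_def[of "rearr_real f"])
qed

section \<open>Power weights and dyadic sums\<close>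

text \<open>
  This identity turns \<open>a powr r\<close>, the shape of the norm of an indicator function, into an integral
  against the weight of the Lorentz norm.
\<close>

lemma nn_integral_power_weight:
  assumes "0 < r" "0 \<le> a"
  shows "(\<integral>\<^sup>+t. indicator {t. 0 < t \<and> ennreal t < ennreal a} t * ennreal (t powr (r - 1)) \<partial>lborel)
    = ennreal (a powr r / r)"
proof -
  have "(\<integral>\<^sup>+t. ennreal (indicator {0..a} t * t powr (r - 1)) \<partial>lborel) = ennreal (a powr r / r)"
    using has_integral_powr_from_0[of "r - 1" a] assms
    by (intro nn_integral_has_integral_lebesgue) auto
  moreover have "(\<integral>\<^sup>+t. indicator {t. 0 < t \<and> ennreal t < ennreal a} t * ennreal (t powr (r - 1)) \<partial>lborel)
     = (\<integral>\<^sup>+t. ennreal (indicator {0..a} t * t powr (r - 1)) \<partial>lborel)"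
  proof (rule nn_integral_cong_AE)
    show "AE t in lborel. indicator {t. 0 < t \<and> ennreal t < ennreal a} t * ennreal (t powr (r - 1))
       = ennreal (indicator {0..a} t * t powr (r - 1))"
      using AE_lborel_singleton[of a]
      by eventually_elim (auto simp: indicator_def ennreal_less_iff)
  qed
  ultimately show ?thesis by simp
qed

text \<open>
  Below the largest power \<open>2^b\<close> that occurs, distinct powers of two sum up to at most \<open>2^b\<close>.
\<close>

lemma sum_dyadic_le:
  fixes A :: "int set"
  assumes "finite A" "0 \<le> y" "\<And>k. k \<in> A \<Longrightarrow> 2 powi k \<le> y"
  shows "(\<Sum>k\<in>A. 2 powi k) \<le> 2 * (y::real)"
  using assms
proof (induction A arbitrary: y rule: finite_linorder_max_induct)
  case (insert b A)
  have "2 powi k \<le> (2 powi b / 2 :: real)" if "k \<in> A" for k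
  proof -
    have "(2::real) powi k \<le> 2 powi (b - 1)"
      using insert.hyps(2) that by (intro power_int_increasing) auto
    then show ?thesis by (simp add: power_int_diff)
  qed
  then have "(\<Sum>k\<in>A. 2 powi k) \<le> 2 * (2 powi b / 2 :: real)"
    by (intro insert.IH) auto
  moreover have "b \<notin> A" using insert.hyps by auto
  ultimately show ?case
    using insert.prems(2)[of b] insert.hyps(1) by simp
qed auto

lemma dyadic_below:
  assumes "0 < (y::real)" shows "\<exists>k::int. 2 powi k < y \<and> y \<le> 2 * 2 powi k"
proof -
  define k where "k = \<lceil>log 2 y\<rceil> - 1"
  have "real_of_int k < log 2 y" "log 2 y \<le> k + 1"
    unfolding k_def by linarith+
  then have "2 powr k < y" "y \<le> 2 powr (k + 1)"
    using assms by (auto simp: less_log_iff log_le_iff)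
  then show ?thesis
    by (intro exI[of _ k]) (auto simp: powr_real_of_int' powr_add)
qed

section \<open>Rearrangement-invariant norms and dyadic level sets\<close>

context ri_norm
begin

lemma N_cong_dist:
  assumes "f \<in> meas_funs" "g \<in> meas_funs" "\<And>s. 0 < s \<Longrightarrow> dist_fun f s = dist_fun g s"
  shows "N f = N g"
proof (rule P6[OF assms(1,2)])
  have "rearr f = rearr g" by (rule rearr_cong) (rule assms(3))
  then show "\<forall>t>0. rearr f t = rearr g t" by simp
qed

lemma N_abs: "f \<in> meas_funs \<Longrightarrow> N (\<lambda>x. \<bar>f x\<bar>) = N f"
  by (rule N_cong_dist) (auto simp: dist_fun_def meas_funs_def)

lemma N_mono:
  assumes "f \<in> meas_funs" "g \<in> meas_funs" "\<And>x. 0 \<le> x \<Longrightarrow> 0 \<le> g x \<and> g x \<le> f x"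
  shows "N g \<le> N f"
  using assms(3) by (intro P2[OF assms(1,2)] AE_I2) simp

lemma N_sum_indicator_le:
  assumes "finite A" "\<And>k. k \<in> A \<Longrightarrow> 0 \<le> a k" "\<And>k. k \<in> A \<Longrightarrow> E k \<in> sets halfline"
  shows "N (\<lambda>x. \<Sum>k\<in>A. a k * indicator (E k) x) \<le> (\<Sum>k\<in>A. ennreal (a k) * N (indicator (E k)))"
  using assms
proof (induction A rule: finite_induct)
  case empty
  have "N (\<lambda>x. 0) = 0"
    by (subst P1_zero) (auto simp: meas_funs_def)
  then show ?case by simp
next
  case (insert k A)
  have m: "(\<lambda>x. a j * indicator (E j) x) \<in> meas_funs" "indicator (E j) \<in> meas_funs" if "j \<in> insert k A" for j
    using insert.prems(2)[OF that] by (auto simp: meas_funs_def)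
  have mA: "(\<lambda>x. \<Sum>j\<in>A. a j * indicator (E j) x) \<in> meas_funs"
    using m(1) unfolding meas_funs_def by (intro borel_measurable_sum) auto
  have "N (\<lambda>x. \<Sum>j\<in>insert k A. a j * indicator (E j) x)
      = N (\<lambda>x. a k * indicator (E k) x + (\<Sum>j\<in>A. a j * indicator (E j) x))"
    using insert.hyps by (simp only: sum.insert not_False_eq_True)
  also have "\<dots> \<le> N (\<lambda>x. a k * indicator (E k) x) + N (\<lambda>x. \<Sum>j\<in>A. a j * indicator (E j) x)"
    by (intro P1_triangle m mA) simp
  also have "N (\<lambda>x. a k * indicator (E k) x) = ennreal (a k) * N (indicator (E k))"
    using P1_scale[OF m(2)[of k]] insert.prems(1)[of k] by simp
  also have "N (\<lambda>x. \<Sum>j\<in>A. a j * indicator (E j) x) \<le> (\<Sum>j\<in>A. ennreal (a j) * N (indicator (E j)))"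
    using insert by auto
  finally show ?case
    using insert.hyps by (simp add: add_left_mono)
qed

text \<open>
  A function is comparable to the superposition \<open>h = (\<Sum>k. 2^k * indicator {\<bar>f\<bar> > 2^k})\<close> of its dyadic
  level sets: the sum is at least its largest nonzero term, which is at least \<open>\<bar>f\<bar>/2\<close>, and it converges
  because it is at most \<open>2\<bar>f\<bar>\<close>.  The symmetric partial sums of \<open>h\<close> increase, so the Fatou property (P3)
  passes from finite subadditivity to the whole series.
\<close>

lemma N_dyadic_le:
  assumes f: "f \<in> meas_funs"
    and B: "\<And>n::nat. (\<Sum>k\<in>{-int n..int n}. ennreal (2 powi k) * N (indicator {x \<in> {0..}. 2 powi k < \<bar>f x\<bar>})) \<le> B"
  shows "N f \<le> 2 * B"
proof -
  define E where "E k = {x \<in> {0..}. 2 powi k < \<bar>f x\<bar>}" for k :: int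
  \<comment> \<open>Partial sums run over a symmetric range of exponents, since \<open>f\<close> may be unbounded
    as well as arbitrarily small without vanishing.\<close>
  define h where "h n x = (\<Sum>k\<in>{-int n..int n}. 2 powi k * indicator (E k) x :: real)" for n x
  define H where "H x = lim (\<lambda>n. h n x)" for x
  have E: "E k \<in> sets halfline" for k
    unfolding E_def by (rule level_sets[OF f])
  have h_meas: "h n \<in> meas_funs" for n
    unfolding meas_funs_def h_def
    by (intro borel_measurable_sum borel_measurable_times borel_measurable_const
        borel_measurable_indicator E)
  have h_nonneg: "0 \<le> h n x" for n x
    unfolding h_def by (intro sum_nonneg) auto
  have inc: "incseq (\<lambda>n. h n x)" for x
    unfolding h_def by (intro monoI sum_mono2) auto
  have bound: "h n x \<le> 2 * \<bar>f x\<bar>" for n x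
  proof -
    have "h n x = (\<Sum>k | k \<in> {-int n..int n} \<and> x \<in> E k. 2 powi k)"
      unfolding h_def by (intro sum.mono_neutral_cong_right) auto
    also have "\<dots> \<le> 2 * \<bar>f x\<bar>"
    proof (rule sum_dyadic_le)
      show "finite {k. k \<in> {-int n..int n} \<and> x \<in> E k}"
        by (rule finite_subset[of _ "{-int n..int n}"]) auto
    qed (auto simp: E_def)
    finally show ?thesis .
  qed
  have lim: "(\<lambda>n. h n x) \<longlonglongrightarrow> H x" for x
  proof -
    obtain L where "(\<lambda>n. h n x) \<longlonglongrightarrow> L"
      using incseq_convergent[OF inc, of x "2 * \<bar>f x\<bar>"] bound by blast
    then show ?thesis unfolding H_def by (simp add: limI)
  qed
  have H_meas: "H \<in> meas_funs"
    unfolding meas_funs_def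
    by (rule borel_measurable_LIMSEQ_real[OF lim meas_funs_measurable[OF h_meas]])
  have lower: "\<bar>f x\<bar> / 2 \<le> H x" if "0 \<le> x" for x
  proof (cases "f x = 0")
    case True
    have "0 \<le> H x"
      by (rule LIMSEQ_le_const[OF lim]) (simp add: h_nonneg)
    then show ?thesis using True by simp
  next
    case False
    then obtain k :: int where k: "2 powi k < \<bar>f x\<bar>" "\<bar>f x\<bar> \<le> 2 * 2 powi k"
      using dyadic_below[of "\<bar>f x\<bar>"] by auto
    define n where "n = nat \<bar>k\<bar>"
    have "2 powi k * indicator (E k) x \<le> h n x"
      unfolding h_def by (rule member_le_sum) (auto simp: n_def)
    then have "\<bar>f x\<bar> / 2 \<le> h n x"
      using k that by (auto simp: E_def)
    also have "\<dots> \<le> H x"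
      by (rule incseq_le[OF inc lim])
    finally show ?thesis .
  qed
  have "(\<lambda>n. N (h n)) \<longlonglongrightarrow> N H"
    by (intro conjunct2[OF P3[OF h_meas H_meas]] AE_I2 conjI allI inc lim h_nonneg)
  moreover have "N (h n) \<le> B" for n
  proof -
    have "N (h n) \<le> (\<Sum>k\<in>{-int n..int n}. ennreal (2 powi k) * N (indicator (E k)))"
      unfolding h_def by (intro N_sum_indicator_le E) auto
    also have "\<dots> \<le> B" unfolding E_def by (rule B)
    finally show ?thesis .
  qed
  ultimately have NH: "N H \<le> B"
    by (intro LIMSEQ_le_const2[of "\<lambda>n. N (h n)"]) auto
  have "N f \<le> 2 * N H"
  proof -
    have "N f = N (\<lambda>x. \<bar>f x\<bar>)" by (rule N_abs[OF f, symmetric])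
    also have "\<dots> \<le> N (\<lambda>x. 2 * H x)"
    proof (rule N_mono)
      fix x :: real assume "0 \<le> x"
      from lower[OF this] show "0 \<le> \<bar>f x\<bar> \<and> \<bar>f x\<bar> \<le> 2 * H x" by simp
    qed (use f H_meas in \<open>simp_all add: meas_funs_def\<close>)
    also have "\<dots> = 2 * N H"
      using P1_scale[OF H_meas, of 2] by simp
    finally show ?thesis .
  qed
  moreover have "2 * N H \<le> 2 * B"
    by (rule mult_left_mono) (rule NH, simp)
  ultimately show ?thesis by (rule order_trans)
qed

end

lemma dist_fun_indicator:
  assumes "E \<subseteq> {0..}" "0 < s"
  shows "dist_fun (indicator E) s = (if s < 1 then emeasure halfline E else 0)"
proof -
  have "{x \<in> space halfline. s < \<bar>indicator E x :: real\<bar>} = (if s < 1 then E else {})"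
    using assms by (auto simp: indicator_def split: if_splits)
  then show ?thesis by (simp add: dist_fun_def)
qed

text \<open>
  The summand of index \<open>k\<close> is nonzero only if \<open>2^k < rearr f t\<close>, so this is a sum of distinct powers of
  two below \<open>rearr f t\<close>.
\<close>

lemma sum_dyadic_rearr_le:
  assumes f: "f \<in> meas_funs" and A: "finite A"
  shows "(\<Sum>k\<in>A. ennreal (2 powi k) * indicator {t. 0 < t \<and> ennreal t < dist_fun f (2 powi k)} t)
    \<le> 2 * (rearr f t * indicator {0<..} t)"
proof (cases "0 < t")
  case True
  let ?A = "{k \<in> A. ennreal t < dist_fun f (2 powi k)}"
  have "(\<Sum>k\<in>A. ennreal (2 powi k) * indicator {t. 0 < t \<and> ennreal t < dist_fun f (2 powi k)} t)
      = (\<Sum>k\<in>?A. ennreal (2 powi k))"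
    using A True by (intro sum.mono_neutral_cong_right) auto
  also have "\<dots> = ennreal (\<Sum>k\<in>?A. 2 powi k)"
    by (rule sum_ennreal) auto
  also have "\<dots> \<le> 2 * rearr f t"
  proof (cases "rearr f t")
    case (real y)
    have "(\<Sum>k\<in>?A. 2 powi k) \<le> 2 * y"
    proof (rule sum_dyadic_le)
      fix k assume "k \<in> ?A"
      then have "ennreal (2 powi k) < rearr f t"
        by (subst less_rearr_iff[OF f]) auto
      then show "2 powi k \<le> y"
        using real by (simp add: ennreal_less_iff)
    qed (use A real in auto)
    then have "ennreal (\<Sum>k\<in>?A. 2 powi k) \<le> ennreal (2 * y)" by (rule ennreal_leI)
    then show ?thesis using real by (simp add: ennreal_mult)
  qed (simp add: ennreal_mult_top)
  finally show ?thesis using True by simp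
qed (auto simp: indicator_def)

section \<open>Homogeneous norms\<close>

text \<open>
  The parameter \<open>r\<close> stands for \<open>1/p\<close>, so that \<open>r = 0\<close> is the case \<open>p = \<infinity>\<close>.
\<close>

locale homogeneous_ri_norm = ri_norm +
  fixes r :: real
  assumes r_nonneg: "0 \<le> r"
    and homogeneous: "\<And>f a. f \<in> fun_space N \<Longrightarrow> 0 < a \<Longrightarrow> N (dilation a f) = ennreal (a powr (- r)) * N f"
begin

definition unit_norm :: real where "unit_norm = enn2real (N (indicator {0..<1}))"

lemma N_unit_indicator: "N (indicator {0..<1}) = ennreal unit_norm" and unit_norm_pos: "0 < unit_norm"
proof -
  have fin: "N (indicator {0..<1}) < \<infinity>"
    using sets_halfline_interval[of 1] emeasure_halfline_interval[of 1] by (intro P4) auto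
  then show "N (indicator {0..<1}) = ennreal unit_norm" by (simp add: unit_norm_def)
  have "N (indicator {0..<1}) \<noteq> 0"
  proof
    assume "N (indicator {0..<1}) = 0"
    then have "AE x in halfline. indicator {0..<1} x = (0::real)"
      using sets_halfline_interval[of 1] by (subst (asm) P1_zero) (auto simp: meas_funs_def)
    then have "AE x in halfline. x \<notin> {0..<1}"
      by eventually_elim (auto simp: indicator_def split: if_splits)
    then have "emeasure halfline {0..<1::real} = 0"
      using sets_halfline_interval[of 1] by (simp add: AE_iff_measurable[OF _ refl] AE_iff_null_sets null_setsD1)
    then show False by (simp add: emeasure_halfline_interval)
  qed
  then show "0 < unit_norm" using fin by (simp add: unit_norm_def enn2real_positive_iff zero_less_iff_neq_zero)
qed

text \<open>
  The set \<open>E\<close> is equimeasurable with \<open>[0, a)\<close>, whose indicator function is a dilation of that of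
  \<open>[0, 1)\<close>.
\<close>

lemma N_indicator:
  assumes E: "E \<in> sets halfline" "emeasure halfline E = ennreal a" and a: "0 < a"
  shows "N (indicator E) = ennreal (unit_norm * a powr r)"
proof -
  have m: "indicator {0..<b} \<in> meas_funs" for b :: real
    using sets_halfline_interval[of b] by (simp add: meas_funs_def)
  have "E \<subseteq> {0..}" using sets.sets_into_space[OF E(1)] by simp
  have "N (indicator E) = N (indicator {0..<a})"
  proof (intro N_cong_dist m)
    fix s :: real assume s: "0 < s"
    have "dist_fun (indicator {0..<a}) s = (if s < 1 then emeasure halfline {0..<a} else 0)"
      using s by (intro dist_fun_indicator) auto
    then show "dist_fun (indicator E) s = dist_fun (indicator {0..<a}) s"
      using \<open>E \<subseteq> {0..}\<close> s a E(2) by (simp only: dist_fun_indicator emeasure_halfline_interval less_imp_le)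
  qed (use E(1) in \<open>simp add: meas_funs_def\<close>)
  also have "indicator {0..<a} = dilation (1 / a) (indicator {0..<1::real})"
    using a by (auto simp: dilation_def indicator_def fun_eq_iff field_simps)
  also have "N \<dots> = ennreal ((1 / a) powr (- r)) * N (indicator {0..<1})"
    using a m N_unit_indicator by (intro homogeneous) (auto simp: fun_space_def)
  also have "\<dots> = ennreal (unit_norm * a powr r)"
    using a unit_norm_pos by (simp add: N_unit_indicator powr_divide powr_minus_divide ennreal_mult mult.commute)
  finally show ?thesis .
qed

text \<open>
  The level set contains subsets of finite measure larger than \<open>t\<close>, and \<open>\<bar>f\<bar>\<close> is at least \<open>s\<close> on them.
  Passing to a subset covers level sets of infinite measure as well.
\<close>

lemma N_ge_level:
  assumes f: "f \<in> meas_funs" and s: "0 \<le> s" and t: "0 < t" "ennreal t < dist_fun f s"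
  shows "ennreal (s * unit_norm * t powr r) \<le> N f"
proof -
  define F where "F n = {x \<in> {0..}. s < \<bar>f x\<bar>} \<inter> {0..<real n}" for n
  have F: "F n \<in> sets halfline" for n
    unfolding F_def using level_sets[OF f] sets_halfline_interval by blast
  have "(SUP n. emeasure halfline (F n)) = emeasure halfline (\<Union>n. F n)"
    using F by (intro SUP_emeasure_incseq) (auto simp: F_def incseq_def)
  also have "(\<Union>n. F n) = {x \<in> space halfline. s < \<bar>f x\<bar>}"
    by (auto simp: F_def intro: reals_Archimedean2)
  finally obtain n where n: "ennreal t < emeasure halfline (F n)"
    using t(2) by (metis less_SUP_iff dist_fun_def)
  have "emeasure halfline (F n) \<le> ennreal (real n)"
    using emeasure_mono[of "F n" "{0..<real n}" halfline] sets_halfline_interval[of "real n"]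
        emeasure_halfline_interval[of "real n"] by (auto simp: F_def)
  then obtain a where a: "emeasure halfline (F n) = ennreal a" "0 \<le> a"
    by (cases "emeasure halfline (F n)") (auto simp: top_unique)
  then have "t < a" using n t by (simp add: ennreal_less_iff)
  have "s * unit_norm * t powr r \<le> s * (unit_norm * a powr r)"
    unfolding mult.assoc using \<open>t < a\<close> t s unit_norm_pos r_nonneg by (intro mult_left_mono powr_mono2) auto
  then have "ennreal (s * unit_norm * t powr r) \<le> ennreal (s * (unit_norm * a powr r))"
    by (rule ennreal_leI)
  also have "\<dots> = ennreal s * N (indicator (F n))"
    using s unit_norm_pos a \<open>t < a\<close> t by (simp add: N_indicator[OF F] ennreal_mult)
  also have "\<dots> = N (\<lambda>x. s * indicator (F n) x)"
    using P1_scale[of "indicator (F n)" s] F s by (simp add: meas_funs_def)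
  also have "\<dots> \<le> N (\<lambda>x. \<bar>f x\<bar>)"
  proof (rule N_mono)
    show "(\<lambda>x. \<bar>f x\<bar>) \<in> meas_funs" "(\<lambda>x. s * indicator (F n) x) \<in> meas_funs"
      using f F by (simp_all add: meas_funs_def)
  qed (use s in \<open>auto simp: F_def indicator_def\<close>)
  also have "\<dots> = N f" by (rule N_abs[OF f])
  finally show ?thesis .
qed

text \<open>
  If \<open>rearr f t\<close> exceeded \<open>s\<close>, the norm of \<open>f\<close> would be at least a multiple of \<open>s\<close> depending only on
  \<open>t\<close>.
\<close>

lemma rearr_finite:
  assumes f: "f \<in> fun_space N" and t: "0 < t"
  shows "rearr f t < \<infinity>"
proof -
  have fm: "f \<in> meas_funs" and "N f < \<infinity>" using f by (auto simp: fun_space_def)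
  then obtain y where y: "N f = ennreal y" "0 \<le> y" by (cases "N f") auto
  have pos: "0 < unit_norm * t powr r" using unit_norm_pos t by simp
  \<comment> \<open>Where \<open>t < dist_fun f s\<close>, the norm is at least \<open>s * unit_norm * t powr r\<close>; this \<open>s\<close> makes that \<open>y + 1\<close>.\<close>
  define s where "s = (y + 1) / (unit_norm * t powr r)"
  have "0 \<le> s" using y pos by (simp add: s_def)
  have "\<not> ennreal t < dist_fun f s"
  proof
    assume "ennreal t < dist_fun f s"
    from N_ge_level[OF fm \<open>0 \<le> s\<close> t this] have "s * (unit_norm * t powr r) \<le> y"
      using y by (simp add: mult.assoc)
    then show False using pos unit_norm_pos t by (simp add: s_def)
  qed
  then have "rearr f t \<le> ennreal s"
    using less_rearr_iff[OF fm \<open>0 \<le> s\<close>, of t] by (meson not_less)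
  then show ?thesis by (rule le_less_trans) simp
qed

text \<open>
  Averaging over \<open>(0, t)\<close> is the same as dilating by \<open>t\<close> and then integrating over \<open>[0, 1)\<close>, so a
  single constant, the one that (P5) gives for \<open>[0, 1)\<close>, serves all \<open>t\<close>.  The dilation is applied to the
  rearrangement, which has the same norm as \<open>f\<close>.
\<close>

lemma max_rearr_le_N:
  obtains C :: real where "0 < C"
    "\<And>f t. f \<in> fun_space N \<Longrightarrow> 0 < t \<Longrightarrow>
       max_rearr f t \<le> ennreal (C * t powr (- r)) * N f"
proof -
  obtain C :: real where C: "0 < C"
    "\<And>g. g \<in> meas_funs \<Longrightarrow> (AE x in halfline. 0 \<le> g x) \<Longrightarrow>
       (\<integral>\<^sup>+x\<in>{0..<1}. ennreal (g x) \<partial>halfline) \<le> ennreal C * N g"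
    using P5[of "{0..<1}"] sets_halfline_interval[of 1] emeasure_halfline_interval[of 1] by auto
  show thesis
  proof (rule that[OF C(1)])
    fix f and t :: real
    assume f: "f \<in> fun_space N" and t: "0 < t"
    then have fm: "f \<in> meas_funs" by (simp add: fun_space_def)
    define g where "g = rearr_real f"
    have gb [measurable]: "g \<in> borel_measurable borel"
      unfolding g_def using fm by measurable
    have gm: "g \<in> meas_funs" by (rule meas_funs_borel[OF gb])
    have g0: "0 \<le> g x" for x by (simp add: g_def rearr_real_def)
    have gf: "ennreal (g x) = rearr f x" if "0 < x" for x
      using rearr_finite[OF f that] that by (simp add: g_def rearr_real_def)
    have Ng: "N g = N f"
      using rearr_rearr_real[OF fm rearr_finite[OF f]] by (intro P6 gm fm) (simp add: g_def)
    have dm [measurable]: "dilation t g \<in> borel_measurable borel"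
      unfolding dilation_def by measurable
    have "(\<integral>\<^sup>+s\<in>{0<..<t}. rearr f s \<partial>lborel) = (\<integral>\<^sup>+s. ennreal (g s) * indicator {0<..<t} s \<partial>lborel)"
      by (intro nn_integral_cong) (simp add: gf split: split_indicator)
    also have "\<dots> = ennreal t * (\<integral>\<^sup>+x. ennreal (g (t * x)) * indicator {0<..<t} (t * x) \<partial>lborel)"
      using t nn_integral_real_affine[of "\<lambda>s. ennreal (g s) * indicator {0<..<t} s" t 0] by simp
    also have "(\<integral>\<^sup>+x. ennreal (g (t * x)) * indicator {0<..<t} (t * x) \<partial>lborel)
        \<le> (\<integral>\<^sup>+x. ennreal (dilation t g x) * indicator {0..<1} x * indicator {0..} x \<partial>lborel)"
      using t by (intro nn_integral_mono) (auto simp: dilation_def indicator_def zero_less_mult_iff)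
    also have "\<dots> = (\<integral>\<^sup>+x\<in>{0..<1}. ennreal (dilation t g x) \<partial>halfline)"
      by (simp add: nn_integral_restrict_space nn_integral_completion)
    also have "\<dots> \<le> ennreal C * N (dilation t g)"
      using g0 by (intro C(2) meas_funs_borel dm) (auto simp: dilation_def)
    also have "N (dilation t g) = ennreal (t powr (- r)) * N f"
      using f t gm Ng by (subst homogeneous) (auto simp: fun_space_def)
    finally have "(\<integral>\<^sup>+s\<in>{0<..<t}. rearr f s \<partial>lborel)
        \<le> ennreal t * (ennreal C * (ennreal (t powr (- r)) * N f))"
      by (simp add: mult_left_mono)
    then have "max_rearr f t \<le> ennreal (1 / t) * (ennreal t * (ennreal C * (ennreal (t powr (- r)) * N f)))"
      unfolding max_rearr_eq by (rule mult_left_mono) simp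
    also have "\<dots> = ennreal (C * t powr (- r)) * N f"
      using t C(1) by (simp add: mult.assoc[symmetric] ennreal_mult'[symmetric])
    finally show "max_rearr f t \<le> ennreal (C * t powr (- r)) * N f" .
  qed
qed

text \<open>
  The right-hand side is \<open>unit_norm * m powr r\<close> for \<open>m = emeasure halfline E\<close>, written so that it also
  makes sense, with value \<open>\<infinity>\<close>, for sets of infinite measure.  Those are exhausted by the sets
  \<open>E \<inter> [0, n)\<close>.
\<close>

lemma N_indicator_le_power_integral:
  assumes r: "0 < r" and E: "E \<in> sets halfline"
  shows "N (indicator E) \<le> ennreal (unit_norm * r) *
    (\<integral>\<^sup>+t. indicator {t. 0 < t \<and> ennreal t < emeasure halfline E} t * ennreal (t powr (r - 1)) \<partial>lborel)"
    (is "_ \<le> ennreal (unit_norm * r) * ?W (emeasure halfline E)")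
proof -
  define F where "F n = E \<inter> {0..<real n}" for n
  have F: "F n \<in> sets halfline" for n
    unfolding F_def using E sets_halfline_interval by blast
  have "(\<lambda>n. N (indicator (F n))) \<longlonglongrightarrow> N (indicator E)"
  proof (rule conjunct2[OF P3])
    show "AE x in halfline. (\<forall>n. 0 \<le> (indicator (F n) x :: real)) \<and> incseq (\<lambda>n. indicator (F n) x :: real)
       \<and> (\<lambda>n. indicator (F n) x :: real) \<longlonglongrightarrow> indicator E x"
    proof (intro AE_I2 conjI)
      fix x :: real assume "x \<in> space halfline"
      moreover obtain m :: nat where "x < real m" using reals_Archimedean2 by blast
      ultimately have "\<forall>\<^sub>F n in sequentially. indicator (F n) x = (indicator E x :: real)"
        by (intro eventually_sequentiallyI[of m]) (auto simp: F_def indicator_def)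
      then show "(\<lambda>n. indicator (F n) x :: real) \<longlonglongrightarrow> indicator E x"
        by (rule tendsto_eventually)
    qed (simp, auto simp: F_def incseq_def indicator_def)
  qed (use F E in \<open>auto simp: meas_funs_def\<close>)
  moreover have "N (indicator (F n)) \<le> ennreal (unit_norm * r) * ?W (emeasure halfline E)" for n
  proof -
    have "emeasure halfline (F n) \<le> ennreal (real n)"
      using emeasure_mono[of "F n" "{0..<real n}" halfline] sets_halfline_interval[of "real n"]
        emeasure_halfline_interval[of "real n"] by (auto simp: F_def)
    then obtain a where a: "emeasure halfline (F n) = ennreal a" "0 \<le> a"
      by (cases "emeasure halfline (F n)") (auto simp: top_unique)
    show ?thesis
    proof (cases "a = 0")
      case True
      then have "F n \<in> null_sets halfline" using a F by (auto intro: null_setsI)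
      then have "AE x in halfline. indicator (F n) x = (0::real)"
        by (rule AE_not_in[THEN AE_mp]) (auto simp: indicator_def)
      then have "N (indicator (F n)) = 0"
        using F by (subst P1_zero) (auto simp: meas_funs_def)
      then show ?thesis by simp
    next
      case False
      have "N (indicator (F n)) = ennreal (unit_norm * r) * ?W (ennreal a)"
        using False a r unit_norm_pos
        by (simp only: nn_integral_power_weight N_indicator[OF F a(1)])
          (simp add: N_indicator[OF F a(1)] ennreal_mult'[symmetric])
      also have "\<dots> \<le> ennreal (unit_norm * r) * ?W (emeasure halfline E)"
      proof (intro mult_left_mono nn_integral_mono)
        fix t
        have "ennreal a \<le> emeasure halfline E"
          unfolding a(1)[symmetric] using E by (intro emeasure_mono) (auto simp: F_def)
        then show "indicator {t. 0 < t \<and> ennreal t < ennreal a} t * ennreal (t powr (r - 1))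
          \<le> indicator {t. 0 < t \<and> ennreal t < emeasure halfline E} t * ennreal (t powr (r - 1))"
          by (auto simp: indicator_def)
      qed simp
      finally show ?thesis .
    qed
  qed
  ultimately show ?thesis
    by (intro LIMSEQ_le_const2) auto
qed

text \<open>
  The integral on the right is the Lorentz norm with \<open>f\<^sup>*\<close> in place of \<open>f\<^sup>*\<^sup>*\<close>.  Each dyadic level set
  contributes an integral of the weight \<open>t powr (r - 1)\<close> over \<open>(0, dist_fun f (2^k))\<close>; under the integral
  sign the dyadic sum collapses to at most \<open>2 * rearr f t\<close>.  The factor 4 is this 2 times the 2 lost in the
  dyadic decomposition.
\<close>

lemma N_le_weighted_rearr:
  assumes r: "0 < r" and f: "f \<in> meas_funs"
  shows "N f \<le> ennreal (4 * unit_norm * r) * (\<integral>\<^sup>+t\<in>{0<..}. rearr f t * ennreal (t powr (r - 1)) \<partial>lborel)"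
    (is "_ \<le> _ * ?R")
proof -
  have [measurable]: "rearr f \<in> borel_measurable borel" using f by measurable
  let ?I = "\<lambda>k t. indicator {t. 0 < t \<and> ennreal t < dist_fun f (2 powi k)} t :: ennreal"
  let ?w = "\<lambda>t. ennreal (t powr (r - 1))"
  have "N f \<le> 2 * (ennreal (unit_norm * r) * (2 * ?R))"
  proof (rule N_dyadic_le[OF f])
    fix n :: nat
    let ?K = "{-int n..int n}"
    have m: "(\<lambda>t. ennreal (2 powi k) * (?I k t * ?w t)) \<in> borel_measurable lborel" for k
      by measurable
    have "(\<Sum>k\<in>?K. ennreal (2 powi k) * N (indicator {x \<in> {0..}. 2 powi k < \<bar>f x\<bar>}))
        \<le> (\<Sum>k\<in>?K. ennreal (2 powi k) * (ennreal (unit_norm * r) * (\<integral>\<^sup>+t. ?I k t * ?w t \<partial>lborel)))"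
      using N_indicator_le_power_integral[OF r level_sets[OF f]]
      by (intro sum_mono mult_left_mono) (auto simp: dist_fun_def)
    also have "\<dots> = ennreal (unit_norm * r) * (\<Sum>k\<in>?K. \<integral>\<^sup>+t. ennreal (2 powi k) * (?I k t * ?w t) \<partial>lborel)"
      by (simp add: nn_integral_cmult sum_distrib_left mult_ac)
    also have "\<dots> = ennreal (unit_norm * r) * (\<integral>\<^sup>+t. (\<Sum>k\<in>?K. ennreal (2 powi k) * ?I k t) * ?w t \<partial>lborel)"
      by (simp only: sum_distrib_right mult.assoc nn_integral_sum[OF m])
    also have "\<dots> \<le> ennreal (unit_norm * r) * (\<integral>\<^sup>+t. 2 * (rearr f t * indicator {0<..} t) * ?w t \<partial>lborel)"
      by (intro mult_left_mono nn_integral_mono mult_right_mono sum_dyadic_rearr_le f) auto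
    also have "(\<integral>\<^sup>+t. 2 * (rearr f t * indicator {0<..} t) * ?w t \<partial>lborel) = 2 * ?R"
      by (subst nn_integral_cmult[symmetric]) (auto simp: mult_ac)
    finally show "(\<Sum>k\<in>?K. ennreal (2 powi k) * N (indicator {x \<in> {0..}. 2 powi k < \<bar>f x\<bar>}))
        \<le> ennreal (unit_norm * r) * (2 * ?R)" .
  qed
  also have "\<dots> = ennreal (4 * unit_norm * r) * ?R"
    using r unit_norm_pos by (simp add: ennreal_mult mult_ac)
  finally show ?thesis .
qed

text \<open>
  Both general bounds concern the integral of \<open>rearr f\<close>, which is the \<open>L\<^sup>1\<close>-norm of \<open>f\<close>: for \<open>r = 1\<close>
  the weight \<open>t powr (r - 1)\<close> in the upper bound is 1, and the lower bound says that the integral over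
  \<open>(0, t)\<close> is bounded independently of \<open>t\<close>.
\<close>

lemma fun_space_eq_L1:
  assumes "r = 1"
  shows "fun_space N = L1_space"
proof -
  have L1: "f \<in> L1_space \<longleftrightarrow> f \<in> meas_funs \<and> (\<integral>\<^sup>+t\<in>{0<..}. rearr f t \<partial>lborel) < \<infinity>" for f
    by (auto simp: L1_space_def integrable_iff_bounded meas_funs_def nn_integral_rearr)
  obtain C where C: "0 < C" "\<And>f t. f \<in> fun_space N \<Longrightarrow> 0 < t \<Longrightarrow>
       max_rearr f t \<le> ennreal (C * t powr (- r)) * N f"
    using max_rearr_le_N by blast
  show ?thesis
  proof (intro equalityI subsetI)
    fix f assume f: "f \<in> fun_space N"
    then have fm: "f \<in> meas_funs" and fin: "N f < \<infinity>" by (auto simp: fun_space_def)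
    have [measurable]: "rearr f \<in> borel_measurable borel" using fm by measurable
    have *: "(\<integral>\<^sup>+s\<in>{0<..<t}. rearr f s \<partial>lborel) \<le> ennreal C * N f" if t: "0 < t" for t
    proof -
      have "(\<integral>\<^sup>+s\<in>{0<..<t}. rearr f s \<partial>lborel) = ennreal t * max_rearr f t"
        unfolding max_rearr_eq using t by (simp add: mult.assoc[symmetric] ennreal_mult'[symmetric])
      also have "\<dots> \<le> ennreal t * (ennreal (C * t powr (- r)) * N f)"
        by (intro mult_left_mono C f t) simp
      also have "\<dots> = ennreal C * N f"
      proof -
        have "ennreal t * ennreal (C * t powr (- r)) = ennreal (t * (C * t powr (- r)))"
          using t ennreal_mult'[of t "C * t powr (- r)"] by simp
        also have "t * (C * t powr (- r)) = C"
          using t assms by (simp add: powr_minus field_simps)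
        finally have "ennreal t * ennreal (C * t powr (- r)) = ennreal C" .
        then show ?thesis by (simp add: mult.assoc[symmetric])
      qed
      finally show ?thesis .
    qed
    have "(\<integral>\<^sup>+s\<in>{0<..}. rearr f s \<partial>lborel) = (\<integral>\<^sup>+s. (SUP n::nat. rearr f s * indicator {0<..<real (Suc n)} s) \<partial>lborel)"
    proof (intro nn_integral_cong antisym SUP_least)
      fix s :: real
      obtain n :: nat where n: "s < real n" using reals_Archimedean2 by blast
      have "rearr f s * indicator {0<..} s \<le> rearr f s * indicator {0<..<real (Suc n)} s"
        using n by (auto simp: indicator_def)
      then show "rearr f s * indicator {0<..} s \<le> (SUP n::nat. rearr f s * indicator {0<..<real (Suc n)} s)"
        by (rule SUP_upper2[OF UNIV_I])
    qed (auto simp: indicator_def)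
    also have "\<dots> = (SUP n::nat. \<integral>\<^sup>+s. rearr f s * indicator {0<..<real (Suc n)} s \<partial>lborel)"
      by (rule nn_integral_monotone_convergence_SUP) (auto simp: incseq_def le_fun_def indicator_def)
    also have "\<dots> \<le> ennreal C * N f"
      by (intro SUP_least *) simp
    also have "\<dots> < \<infinity>" using fin by (simp add: ennreal_mult_less_top)
    finally show "f \<in> L1_space" using fm by (simp add: L1)
  next
    fix f assume "f \<in> L1_space"
    then have f: "f \<in> meas_funs" and fin: "(\<integral>\<^sup>+t\<in>{0<..}. rearr f t \<partial>lborel) < \<infinity>" by (auto simp: L1)
    have "N f \<le> ennreal (4 * unit_norm * r) * (\<integral>\<^sup>+t\<in>{0<..}. rearr f t * ennreal (t powr (r - 1)) \<partial>lborel)"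
      using f assms by (intro N_le_weighted_rearr) auto
    also have "(\<integral>\<^sup>+t\<in>{0<..}. rearr f t * ennreal (t powr (r - 1)) \<partial>lborel) = (\<integral>\<^sup>+t\<in>{0<..}. rearr f t \<partial>lborel)"
      using assms by (intro nn_integral_cong) (auto simp: indicator_def)
    also have "ennreal (4 * unit_norm * r) * \<dots> < \<infinity>"
      using fin by (simp add: ennreal_mult_less_top)
    finally show "f \<in> fun_space N" using f by (simp add: fun_space_def)
  qed
qed

text \<open>
  For \<open>r = 0\<close> every set of positive finite measure has the same norm \<open>unit_norm\<close>.  Hence the constant 1
  has finite norm, by (P3), and a function of finite norm cannot exceed large values on a set of positive
  measure.
\<close>

lemma fun_space_eq_Linf:
  assumes "r = 0"
  shows "fun_space N = Linf_space"
proof (intro equalityI subsetI)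
  fix f assume "f \<in> fun_space N"
  then have f: "f \<in> meas_funs" and "N f < \<infinity>" by (auto simp: fun_space_def)
  then obtain y where y: "N f = ennreal y" "0 \<le> y" by (cases "N f") auto
  define s where "s = (y + 1) / unit_norm"
  have s: "0 \<le> s" using y unit_norm_pos by (simp add: s_def)
  have "dist_fun f s = 0"
  proof (rule ccontr)
    assume "dist_fun f s \<noteq> 0"
    then obtain z where z: "0 < z" "z < dist_fun f s"
      using dense[of 0 "dist_fun f s"] by (auto simp: zero_less_iff_neq_zero)
    then obtain t where t: "z = ennreal t" "0 < t"
      by (cases z) (auto simp: ennreal_less_iff)
    have "ennreal (s * unit_norm * t powr r) \<le> N f"
      using z t by (intro N_ge_level f s) auto
    then show False using t y unit_norm_pos assms by (simp add: s_def)
  qed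
  then have "AE x in halfline. \<bar>f x\<bar> \<le> s"
    using level_sets[OF f, of s] by (intro AE_I[of _ _ "{x \<in> {0..}. s < \<bar>f x\<bar>}"]) (auto simp: dist_fun_def)
  then show "f \<in> Linf_space" using f by (auto simp: Linf_space_def)
next
  fix f assume "f \<in> Linf_space"
  then obtain M where f: "f \<in> meas_funs" and M: "AE x in halfline. \<bar>f x\<bar> \<le> M" by (auto simp: Linf_space_def)
  have m: "indicator {0..<real n} \<in> meas_funs" "(\<lambda>x. 1) \<in> meas_funs" for n
    using sets_halfline_interval[of "real n"] by (auto simp: meas_funs_def)
  have "(\<lambda>n. N (indicator {0..<real n})) \<longlonglongrightarrow> N (\<lambda>x. 1)"
  proof (rule conjunct2[OF P3[OF m]])
    show "AE x in halfline. (\<forall>n. 0 \<le> (indicator {0..<real n} x :: real)) \<and> incseq (\<lambda>n. indicator {0..<real n} x :: real)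
       \<and> (\<lambda>n. indicator {0..<real n} x :: real) \<longlonglongrightarrow> 1"
    proof (intro AE_I2 conjI)
      fix x :: real assume "x \<in> space halfline"
      moreover obtain m :: nat where "x < real m" using reals_Archimedean2 by blast
      ultimately have "\<forall>\<^sub>F n in sequentially. indicator {0..<real n} x = (1 :: real)"
        by (intro eventually_sequentiallyI[of m]) (auto simp: indicator_def)
      then show "(\<lambda>n. indicator {0..<real n} x :: real) \<longlonglongrightarrow> 1"
        by (rule tendsto_eventually)
    qed (simp, auto simp: incseq_def indicator_def)
  qed
  moreover have "N (indicator {0..<real n}) = ennreal unit_norm" if "1 \<le> n" for n
    using that assms N_indicator[OF sets_halfline_interval emeasure_halfline_interval, of "real n"] by simp
  ultimately have "N (\<lambda>x. 1) \<le> ennreal unit_norm"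
    by (intro LIMSEQ_le_const2) (auto intro!: exI[of _ 1])
  have "N f = N (\<lambda>x. \<bar>f x\<bar>)" by (rule N_abs[OF f, symmetric])
  also have "\<dots> \<le> N (\<lambda>x. M * 1)"
    using f M by (intro P2) (auto simp: meas_funs_def)
  also have "\<dots> = ennreal \<bar>M\<bar> * N (\<lambda>x. 1)" by (rule P1_scale[OF m(2)])
  also have "\<dots> \<le> ennreal \<bar>M\<bar> * ennreal unit_norm" by (intro mult_left_mono) (fact, simp)
  also have "\<dots> < \<infinity>" by (simp add: ennreal_mult_less_top)
  finally show "f \<in> fun_space N" using f by (simp add: fun_space_def)
qed

lemma N_le_lorentz_1_norm:
  assumes "recip p = r" "0 < r" and f: "f \<in> meas_funs"
  shows "N f \<le> ennreal (4 * unit_norm * r) * lorentz_1_norm p f"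
proof -
  have "N f \<le> ennreal (4 * unit_norm * r) * (\<integral>\<^sup>+t\<in>{0<..}. rearr f t * ennreal (t powr (r - 1)) \<partial>lborel)"
    by (rule N_le_weighted_rearr[OF assms(2) f])
  also have "\<dots> \<le> ennreal (4 * unit_norm * r) * lorentz_1_norm p f"
    unfolding lorentz_1_norm_def nn_integral_completion assms(1)
    by (intro mult_left_mono nn_integral_mono)
      (auto intro!: mult_right_mono max_rearr_ge f split: split_indicator)
  finally show ?thesis .
qed

lemma lorentz_inf_norm_le_N:
  assumes "recip p = r"
  obtains C :: real where "0 < C"
    "\<And>f. f \<in> fun_space N \<Longrightarrow> lorentz_inf_norm p f \<le> ennreal C * N f"
proof -
  obtain C :: real where C: "0 < C" "\<And>f t. f \<in> fun_space N \<Longrightarrow> 0 < t \<Longrightarrow>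
       max_rearr f t \<le> ennreal (C * t powr (- r)) * N f"
    using max_rearr_le_N by blast
  show thesis
  proof (rule that[OF C(1)])
    fix f assume f: "f \<in> fun_space N"
    show "lorentz_inf_norm p f \<le> ennreal C * N f"
      unfolding lorentz_inf_norm_def assms
    proof (rule SUP_least)
      fix t :: real assume "t \<in> {0<..}"
      then have t: "0 < t" by simp
      have "max_rearr f t * ennreal (t powr r) \<le> ennreal (C * t powr (- r)) * N f * ennreal (t powr r)"
        by (intro mult_right_mono C f t) simp
      also have "\<dots> = ennreal (C * t powr (- r)) * ennreal (t powr r) * N f"
        by (simp only: mult_ac)
      also have "ennreal (C * t powr (- r)) * ennreal (t powr r) = ennreal (C * t powr (- r) * t powr r)"
        by (rule ennreal_mult''[symmetric]) simp
      also have "C * t powr (- r) * t powr r = C"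
        using t by (simp add: powr_minus)
      finally show "max_rearr f t * ennreal (t powr r) \<le> ennreal C * N f" .
    qed
  qed
qed

end

section \<open>Equivalent norms and embeddings\<close>

lemma fun_space_equivalent_norms:
  assumes "equivalent_norms N N'"
  shows "fun_space N = fun_space N'"
proof -
  have *: "fun_space M \<subseteq> fun_space M'" if "\<forall>f\<in>meas_funs. M' f \<le> ennreal C * M f" for M M' C
  proof
    fix f assume "f \<in> fun_space M"
    then have f: "f \<in> meas_funs" "ennreal C * M f < \<infinity>"
      by (simp_all add: fun_space_def ennreal_mult_less_top)
    then show "f \<in> fun_space M'"
      using that le_less_trans[of "M' f" "ennreal C * M f" \<infinity>] by (simp add: fun_space_def)
  qed
  show ?thesis
    using assms * unfolding equivalent_norms_def by (meson subset_antisym)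
qed

lemma embedsI:
  assumes "0 < C" "\<And>f. f \<in> fun_space NX \<Longrightarrow> NY f \<le> ennreal C * NX f"
  shows "embeds NX NY"
proof -
  have "fun_space NX \<subseteq> fun_space NY"
  proof
    fix f assume f: "f \<in> fun_space NX"
    then have "ennreal C * NX f < \<infinity>"
      by (simp add: fun_space_def ennreal_mult_less_top)
    then show "f \<in> fun_space NY"
      using f le_less_trans[OF assms(2)[OF f]] by (simp add: fun_space_def)
  qed
  then show ?thesis
    unfolding embeds_def using assms by blast
qed

theorem proposition2p10:
  fixes p :: ennreal and N :: "(real \<Rightarrow> real) \<Rightarrow> ennreal"
  assumes "1 \<le> p"
    and "ri_norm N"
    and "\<exists>N'. ri_norm N' \<and> p_homogeneous p N' \<and> equivalent_norms N N'"
  shows "(p = 1 \<longrightarrow> fun_space N = L1_space) \<and>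
    (1 < p \<and> p < \<infinity> \<longrightarrow> embeds (lorentz_1_norm p) N \<and> embeds N (lorentz_inf_norm p)) \<and>
    (p = \<infinity> \<longrightarrow> fun_space N = Linf_space)"
proof -
  obtain N' where N': "ri_norm N'" "p_homogeneous p N'" and eq: "equivalent_norms N N'"
    using assms(3) by blast
  interpret ri_norm N' by fact
  interpret homogeneous_ri_norm N' "recip p"
    by unfold_locales (use N'(2) in \<open>auto simp: p_homogeneous_def recip_def\<close>)
  obtain C1 C2 :: real where C1: "0 < C1" "\<And>f. f \<in> meas_funs \<Longrightarrow> N f \<le> ennreal C1 * N' f"
    and C2: "0 < C2" "\<And>f. f \<in> meas_funs \<Longrightarrow> N' f \<le> ennreal C2 * N f"
    using eq unfolding equivalent_norms_def by blast
  have same: "fun_space N = fun_space N'"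
    by (rule fun_space_equivalent_norms[OF eq])
  have "fun_space N = L1_space" if "p = 1"
    unfolding same by (rule fun_space_eq_L1) (simp add: recip_def that)
  moreover have "fun_space N = Linf_space" if "p = \<infinity>"
    unfolding same by (rule fun_space_eq_Linf) (simp add: recip_def that)
  moreover have "embeds (lorentz_1_norm p) N \<and> embeds N (lorentz_inf_norm p)" if p: "1 < p" "p < \<infinity>"
  proof
    have r: "0 < recip p"
    proof (cases p)
      case (real q)
      then have "1 < q" using p by (simp add: ennreal_less_iff flip: ennreal_1)
      then have "1 / p = ennreal (1 / q)"
        using real divide_ennreal[of 1 q] by simp
      then show ?thesis using \<open>1 < q\<close> by (simp add: recip_def)
    qed (use p in simp)
    show "embeds (lorentz_1_norm p) N"
    proof (rule embedsI)
      show "0 < C1 * (4 * unit_norm * recip p)"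
        using C1(1) unit_norm_pos r by simp
      fix f assume "f \<in> fun_space (lorentz_1_norm p)"
      then have f: "f \<in> meas_funs" by (simp add: fun_space_def)
      have "N f \<le> ennreal C1 * N' f" by (rule C1(2)[OF f])
      also have "\<dots> \<le> ennreal C1 * (ennreal (4 * unit_norm * recip p) * lorentz_1_norm p f)"
        by (intro mult_left_mono N_le_lorentz_1_norm f r refl) simp
      also have "\<dots> = ennreal (C1 * (4 * unit_norm * recip p)) * lorentz_1_norm p f"
        by (simp only: ennreal_mult'[OF less_imp_le[OF C1(1)]] mult.assoc)
      finally show "N f \<le> ennreal (C1 * (4 * unit_norm * recip p)) * lorentz_1_norm p f" .
    qed
    obtain C :: real where C: "0 < C"
      "\<And>f. f \<in> fun_space N' \<Longrightarrow> lorentz_inf_norm p f \<le> ennreal C * N' f"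
      using lorentz_inf_norm_le_N[OF refl] by blast
    show "embeds N (lorentz_inf_norm p)"
    proof (rule embedsI)
      show "0 < C * C2" using C(1) C2(1) by simp
      fix f assume f: "f \<in> fun_space N"
      then have fm: "f \<in> meas_funs" by (simp add: fun_space_def)
      have "lorentz_inf_norm p f \<le> ennreal C * N' f"
        using f same by (intro C) simp
      also have "\<dots> \<le> ennreal C * (ennreal C2 * N f)"
        by (intro mult_left_mono C2(2) fm) simp
      also have "\<dots> = ennreal (C * C2) * N f"
        by (simp only: ennreal_mult'[OF less_imp_le[OF C(1)]] mult.assoc)
      finally show "lorentz_inf_norm p f \<le> ennreal (C * C2) * N f" .
    qed
  qed
  ultimately show ?thesis by blast
qed

end
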